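(* Let $\mathbb{X}, \mathbb{Y}$ be normed linear spaces over the same field $\mathbb{K}\in\{\mathbb{R},\mathbb{C}\}$ and let $T\in\mathbb{L}(\mathbb{X},\mathbb{Y})$. Let $x\in S_{\mathbb{X}}$. Then $x\in m_T$ if and only if there exist semi-inner-products $[\cdot,\cdot]_{\mathbb{X}}$ on $\mathbb{X}$ and $[\cdot,\cdot]_{\mathbb{Y}}$ on $\mathbb{Y}$ such that for every $y\in\mathbb{X}$, \[ [Ty,Tx]_{\mathbb{Y}}=m(T)^2\,[y,x]_{\mathbb{X}}. \]
   Context: $S_{\mathbb{X}}=\{x\in\mathbb{X}:\|x\|=1\}$. $\mathbb{L}(\mathbb{X},\mathbb{Y})$ is the space of bounded linear operators from $\mathbb{X}$ to $\mathbb{Y}$. For $T\in\mathbb{L}(\mathbb{X},\mathbb{Y})$, $m(T)=\inf\{\|Tx\|:\|x\|=1\}$ and the minimum norm attainment set is $m_T=\{x\in S_{\mathbb{X}}:\|Tx\|=m(T)\}$. A semi-inner-product (s.i.p.) on a normed space $\mathbb{X}$ over $\mathbb{K}$ is a function $[\cdot,\cdot]:\mathbb{X}\times\mathbb{X}\to\mathbb{K}$ such that for all $\lambda\in\mathbb{K}$, $x,y,z\in\mathbb{X}$: (i) $[x+y,z]=[x,z]+[y,z]$; (ii) $[\lambda x,y]=\lambda[x,y]$; (iii) $[x,x]>0$ whenever $x\neq0$; (iv) $|[x,y]|^2\le[x,x][y,y]$; (v) $[x,\lambda y]=\overline{\lambda}[x,y]$. Semi-inner-products on a normed space are understood to be compatible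 with its norm, i.e. $[x,x]=\|x\|^2$ for all $x$. *)

theory Defs
  imports Complex_Main "HOL-Library.Complex_Order"
begin

text \<open>
  The scalar fields: up to the isometric isomorphism \<open>to_complex\<close> onto its range, an instance
  is either the real or the complex field, with the usual absolute value and conjugation.
\<close>

class real_or_complex = real_normed_field +
  fixes to_complex :: "'a \<Rightarrow> complex"
    and scalar_cnj :: "'a \<Rightarrow> 'a"
  assumes to_complex_add: "to_complex (a + b) = to_complex a + to_complex b"
    and to_complex_mult: "to_complex (a * b) = to_complex a * to_complex b"
    and to_complex_scaleR: "to_complex (r *\<^sub>R a) = r *\<^sub>R to_complex a"
    and norm_to_complex: "norm (to_complex a) = norm a"
    and range_to_complex: "range to_complex = \<real> \<or> range to_complex = UNIV"
    and to_complex_scalar_cnj: "to_complex (scalar_cnj a) = cnj (to_complex a)"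

instantiation real :: real_or_complex
begin

definition to_complex_real :: "real \<Rightarrow> complex" where "to_complex_real = complex_of_real"

definition scalar_cnj_real :: "real \<Rightarrow> real" where "scalar_cnj_real a = a"

instance
  by standard (auto simp: to_complex_real_def scalar_cnj_real_def scaleR_conv_of_real Reals_def)

end

instantiation complex :: real_or_complex
begin

definition to_complex_complex :: "complex \<Rightarrow> complex" where "to_complex_complex a = a"

definition scalar_cnj_complex :: "complex \<Rightarrow> complex" where "scalar_cnj_complex = cnj"

instance
  by standard (auto simp: to_complex_complex_def scalar_cnj_complex_def)

end

text \<open>
  A normed space over the scalar field \<open>'k\<close>. The class \<open>real_normed_vector\<close> supplies the
  additive group and the norm; \<open>scale_of_real\<close> makes its real scalar multiplication the
  restriction of \<open>scale\<close>.
\<close>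

locale normed_space_over = vector_space scale
  for scale :: "'k::real_or_complex \<Rightarrow> 'a::real_normed_vector \<Rightarrow> 'a" +
  assumes norm_scale: "norm (scale c x) = norm c * norm x"
    and scale_of_real: "scale (of_real r) x = r *\<^sub>R x"

lemma normed_space_over_real_iff:
  "normed_space_over (scale :: real \<Rightarrow> 'a::real_normed_vector \<Rightarrow> 'a) \<longleftrightarrow> scale = scaleR"
proof
  assume "normed_space_over scale"
  then interpret normed_space_over scale .
  show "scale = scaleR"
    using scale_of_real by (intro ext) simp
next
  assume "scale = scaleR"
  then show "normed_space_over scale"
    by (unfold_locales) (auto simp: algebra_simps)
qed

definition bounded_linear_over ::
  "('k::real_or_complex \<Rightarrow> 'a::real_normed_vector \<Rightarrow> 'a) \<Rightarrow>
   ('k \<Rightarrow> 'b::real_normed_vector \<Rightarrow> 'b) \<Rightarrow> ('a \<Rightarrow> 'b) \<Rightarrow> bool"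
  where "bounded_linear_over scaleX scaleY T \<longleftrightarrow>
    Vector_Spaces.linear scaleX scaleY T \<and> (\<exists>B. \<forall>x. norm (T x) \<le> B * norm x)"

definition min_norm :: "('a::real_normed_vector \<Rightarrow> 'b::real_normed_vector) \<Rightarrow> real"
  where "min_norm T = Inf {norm (T x) | x. norm x = 1}"

definition min_norm_attainment_set ::
  "('a::real_normed_vector \<Rightarrow> 'b::real_normed_vector) \<Rightarrow> 'a set"
  where "min_norm_attainment_set T = {x. norm x = 1 \<and> norm (T x) = min_norm T}"

text \<open>
  The order relations below are those of \<open>Complex_Order\<close>: \<open>u \<le> v\<close> means that \<open>v - u\<close> is a
  nonnegative real number. So \<open>sip_pos\<close> and \<open>sip_Cauchy_Schwarz\<close> include the claim that the
  quantities compared are real.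
\<close>

locale semi_inner_product = normed_space_over scale
  for scale :: "'k::real_or_complex \<Rightarrow> 'a::real_normed_vector \<Rightarrow> 'a" +
  fixes sip :: "'a \<Rightarrow> 'a \<Rightarrow> 'k"
  assumes sip_add_left: "sip (x + y) z = sip x z + sip y z"
    and sip_scale_left: "sip (scale c x) y = c * sip x y"
    and sip_pos: "x \<noteq> 0 \<Longrightarrow> 0 < to_complex (sip x x)"
    and sip_Cauchy_Schwarz:
      "complex_of_real ((norm (sip x y))\<^sup>2) \<le> to_complex (sip x x * sip y y)"
    and sip_scale_right: "sip x (scale c y) = scalar_cnj c * sip x y"
    and sip_compatible: "sip x x = of_real ((norm x)\<^sup>2)"

end

theory Submission imports Defs begin

text \<open>
  If \<open>x\<close> attains \<open>m = m(T)\<close>, take a norm-one functional \<open>f\<close> supporting the unit ball at \<open>x\<close>.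
  Since \<open>m * \<parallel>y\<parallel> \<le> \<parallel>T y\<parallel>\<close>, the functional \<open>T y \<mapsto> m\<^sup>2 * f y\<close> is bounded by \<open>m * \<parallel>T y\<parallel>\<close>, so by
  Hahn--Banach it extends to a functional on the codomain of norm at most \<open>m = \<parallel>T x\<parallel>\<close>, and this
  extension supports at \<open>T x\<close>. Semi-inner-products whose sections at \<open>x\<close> and \<open>T x\<close> are these
  functionals satisfy the identity. The case \<open>m = 0\<close> needs no separate treatment. The converse is
  the identity at \<open>y = x\<close>. Hahn--Banach is obtained from minimal sublinear functionals, which are
  linear.
\<close>

section \<open>Sublinear functionals and their minimal elements\<close>

definition sublinear :: "('a::real_vector \<Rightarrow> real) \<Rightarrow> bool"
  where "sublinear p \<longleftrightarrow>
    (\<forall>x y. p (x + y) \<le> p x + p y) \<and> (\<forall>r x. 0 \<le> r \<longrightarrow> p (r *\<^sub>R x) = r * p x)"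

lemma sublinear_add: "sublinear p \<Longrightarrow> p (x + y) \<le> p x + p y"
  by (simp add: sublinear_def)

lemma sublinear_scaleR: "sublinear p \<Longrightarrow> 0 \<le> r \<Longrightarrow> p (r *\<^sub>R x) = r * p x"
  by (simp add: sublinear_def)

lemma sublinear_zero: "sublinear p \<Longrightarrow> p 0 = 0"
  using sublinear_scaleR[of p 0 0] by simp

lemma sublinear_minus: "sublinear p \<Longrightarrow> - p (- x) \<le> p x"
  using sublinear_add[of p x "- x"] sublinear_zero[of p] by simp

text \<open>The reverse inequality for \<open>r > 0\<close> is the assumed one for
  \<open>inverse r\<close> at \<open>r *\<^sub>R x\<close>.\<close>

lemma sublinearI:
  assumes add: "\<And>x y. p (x + y) \<le> p x + p y"
    and scale: "\<And>r x. 0 < r \<Longrightarrow> p (r *\<^sub>R x) \<le> r * p x"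
    and zero: "p 0 = 0"
  shows "sublinear p"
  unfolding sublinear_def
proof (intro conjI allI impI)
  fix r :: real and x assume "0 \<le> r"
  show "p (r *\<^sub>R x) = r * p x"
  proof (cases "r = 0")
    case False
    with \<open>0 \<le> r\<close> have r: "0 < r" by simp
    then have "p x \<le> inverse r * p (r *\<^sub>R x)"
      using scale[of "inverse r" "r *\<^sub>R x"] by simp
    then have "r * p x \<le> p (r *\<^sub>R x)"
      using r by (simp add: field_simps)
    with scale[OF r, of x] show ?thesis by simp
  qed (simp add: zero)
qed (rule add)

text \<open>The common majorant \<open>q\<close> keeps the infimum finite, since
  \<open>- q (- x) \<le> - p (- x) \<le> p x\<close>. Subadditivity rests on the chain condition:
  the smaller of two functionals serves at both points.\<close>

lemma sublinear_Inf_chain: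
  fixes C :: "('a::real_vector \<Rightarrow> real) set"
  assumes "C \<noteq> {}" and sub: "\<And>p. p \<in> C \<Longrightarrow> sublinear p"
    and q: "\<And>p x. p \<in> C \<Longrightarrow> p x \<le> q x"
    and chain: "\<And>p p'. p \<in> C \<Longrightarrow> p' \<in> C \<Longrightarrow> p \<le> p' \<or> p' \<le> p"
  shows "sublinear (\<lambda>x. INF p\<in>C. p x)" and "p \<in> C \<Longrightarrow> (INF p\<in>C. p x) \<le> p x"
proof -
  have bdd: "bdd_below ((\<lambda>p. p x) ` C)" for x
  proof (rule bdd_belowI2)
    fix p assume "p \<in> C"
    then show "- q (- x) \<le> p x"
      using sublinear_minus[OF sub, of p x] q[of p "- x"] by simp
  qed
  show low: "(INF p\<in>C. p x) \<le> p x" if "p \<in> C" for p x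
    using that bdd by (intro cINF_lower)
  show "sublinear (\<lambda>x. INF p\<in>C. p x)"
  proof (rule sublinearI)
    fix x y
    have sum: "(INF p\<in>C. p (x + y)) \<le> p x + p' y" if "p \<in> C" "p' \<in> C" for p p'
    proof -
      have "\<exists>p''\<in>C. p'' x \<le> p x \<and> p'' y \<le> p' y"
        using chain[OF that]
      proof
        assume "p \<le> p'"
        then show ?thesis using that(1) by (intro bexI[of _ p]) (auto simp: le_fun_def)
      next
        assume "p' \<le> p"
        then show ?thesis using that(2) by (intro bexI[of _ p']) (auto simp: le_fun_def)
      qed
      then obtain p'' where "p'' \<in> C" "p'' x \<le> p x" "p'' y \<le> p' y" by blast
      then show ?thesis
        using low[of p'' "x + y"] sublinear_add[OF sub, of p'' x y] by linarith
    qed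
    \<comment> \<open>The two infima on the right are taken one after the other, first over
      \<open>p\<close>, then over \<open>p'\<close>.\<close>
    have "(INF p\<in>C. p (x + y)) - p' y \<le> (INF p\<in>C. p x)" if "p' \<in> C" for p'
      using \<open>C \<noteq> {}\<close> sum that by (intro cINF_greatest) (auto simp: algebra_simps)
    then have "(INF p\<in>C. p (x + y)) - (INF p\<in>C. p x) \<le> (INF p\<in>C. p y)"
      using \<open>C \<noteq> {}\<close> by (intro cINF_greatest) (auto simp: algebra_simps)
    then show "(INF p\<in>C. p (x + y)) \<le> (INF p\<in>C. p x) + (INF p\<in>C. p y)"
      by simp
  next
    fix r :: real and x assume r: "0 < r"
    have "(INF p\<in>C. p (r *\<^sub>R x)) / r \<le> (INF p\<in>C. p x)"
    proof (rule cINF_greatest)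
      fix p assume p: "p \<in> C"
      show "(INF p\<in>C. p (r *\<^sub>R x)) / r \<le> p x"
        using low[OF p, of "r *\<^sub>R x"] sublinear_scaleR[OF sub[OF p], of r x] r
        by (simp add: field_simps)
    qed (use \<open>C \<noteq> {}\<close> in auto)
    then show "(INF p\<in>C. p (r *\<^sub>R x)) \<le> r * (INF p\<in>C. p x)"
      using r by (simp add: field_simps)
  next
    have "(INF p\<in>C. p 0) = (INF p\<in>C. 0)"
      using sub by (intro INF_cong) (auto simp: sublinear_zero)
    then show "(INF p\<in>C. p 0) = 0"
      using \<open>C \<noteq> {}\<close> by simp
  qed
qed

text \<open>Zorn's lemma for the sublinear functionals below \<open>q\<close> in the reversed order;
  a nonempty chain is bounded by its pointwise infimum.\<close>

lemma exists_minimal_sublinear: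
  fixes q :: "'a::real_vector \<Rightarrow> real"
  assumes q: "sublinear q"
  obtains p where "sublinear p" "p \<le> q" "\<And>p'. sublinear p' \<Longrightarrow> p' \<le> p \<Longrightarrow> p' = p"
proof -
  define A where "A = {p. sublinear p \<and> p \<le> q}"
  have "\<exists>m\<in>A. \<forall>a\<in>A. a \<le> m \<longrightarrow> a = m"
  proof (rule predicate_Zorn[where P = "\<lambda>a b. b \<le> a"])
    show "partial_order_on A (relation_of (\<lambda>a b. b \<le> a) A)"
      by (rule partial_order_on_relation_ofI) auto
    fix C assume "C \<in> Chains (relation_of (\<lambda>a b. b \<le> a) A)"
    then have chain: "p \<le> p' \<or> p' \<le> p" "p \<in> A" if "p \<in> C" "p' \<in> C" for p p'
      using that by (auto simp: Chains_def relation_of_def)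
    show "\<exists>u\<in>A. \<forall>a\<in>C. u \<le> a"
    proof (cases "C = {}")
      \<comment> \<open>The infimum over an empty chain carries no information; \<open>q\<close>
        itself serves as the bound.\<close>
      case True
      then show ?thesis using q by (auto simp: A_def)
    next
      case False
      have *: "sublinear p" "p x \<le> q x" if "p \<in> C" for p x
        using chain(2)[OF that that] by (auto simp: A_def le_fun_def)
      have inf: "sublinear (\<lambda>x. INF p\<in>C. p x)"
        using False by (rule sublinear_Inf_chain(1)[where q = q]) (simp_all add: * chain(1))
      have low: "(INF p\<in>C. p x) \<le> p x" if "p \<in> C" for p x
        using False _ _ _ that by (rule sublinear_Inf_chain(2)[where q = q]) (simp_all add: * chain(1))
      obtain p0 where "p0 \<in> C" using False by blast
      then have "(INF p\<in>C. p x) \<le> q x" for x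
        using low[of p0 x] *(2)[of p0 x] by linarith
      with inf have "(\<lambda>x. INF p\<in>C. p x) \<in> A"
        by (simp add: A_def le_fun_def)
      then show ?thesis
        using low by (intro bexI) (auto simp: le_fun_def)
    qed
  qed
  then obtain p where "p \<in> A" "\<And>a. a \<in> A \<Longrightarrow> a \<le> p \<Longrightarrow> a = p" by blast
  then show thesis
    by (intro that[of p]) (auto simp: A_def)
qed

lemma minimal_sublinear_add:
  fixes p :: "'a::real_vector \<Rightarrow> real"
  assumes p: "sublinear p" and min: "\<And>p'. sublinear p' \<Longrightarrow> p' \<le> p \<Longrightarrow> p' = p"
  shows "p (x + y) = p x + p y"
proof -
  \<comment> \<open>\<open>g\<close> is again sublinear and below \<open>p\<close>, so minimality gives \<open>p x = g x \<le> p (x + y) - p y\<close>.\<close>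
  define g where "g = (\<lambda>x. INF t\<in>{0..}. p (x + t *\<^sub>R y) - t * p y)"
  \<comment> \<open>Subadditivity,
    \<open>p (t *\<^sub>R y) \<le> p (x + t *\<^sub>R y) + p (- x)\<close>, gives a lower bound
    independent of \<open>t\<close>.\<close>
  have bdd: "bdd_below ((\<lambda>t. p (x + t *\<^sub>R y) - t * p y) ` {0..})" for x
  proof (rule bdd_belowI2)
    fix t :: real assume "t \<in> {0..}"
    then show "- p (- x) \<le> p (x + t *\<^sub>R y) - t * p y"
      using sublinear_add[OF p, of "x + t *\<^sub>R y" "- x"] sublinear_scaleR[OF p, of t y] by simp
  qed
  have low: "g x \<le> p (x + t *\<^sub>R y) - t * p y" if "0 \<le> t" for x t
    unfolding g_def using that bdd by (intro cINF_lower) auto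
  have great: "c \<le> g x" if "\<And>t. 0 \<le> t \<Longrightarrow> c \<le> p (x + t *\<^sub>R y) - t * p y" for c x
    unfolding g_def using that by (intro cINF_greatest) auto
  have "sublinear g"
  proof (rule sublinearI)
    fix a b
    \<comment> \<open>The parameter \<open>s + t\<close> at \<open>a + b\<close> splits into
      \<open>s\<close> for \<open>a\<close> and \<open>t\<close> for \<open>b\<close>.\<close>
    have sum: "g (a + b) \<le> (p (a + s *\<^sub>R y) - s * p y) + (p (b + t *\<^sub>R y) - t * p y)"
      if "0 \<le> s" "0 \<le> t" for s t
      using low[of "s + t" "a + b"] sublinear_add[OF p, of "a + s *\<^sub>R y" "b + t *\<^sub>R y"] that
      by (simp add: algebra_simps)
    have "g (a + b) - (p (b + t *\<^sub>R y) - t * p y) \<le> g a" if "0 \<le> t" for t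
      using sum that by (intro great) (simp add: algebra_simps)
    then have "g (a + b) - g a \<le> g b"
      by (intro great) (simp add: algebra_simps)
    then show "g (a + b) \<le> g a + g b" by simp
  next
    fix r :: real and a assume r: "0 < r"
    have "g (r *\<^sub>R a) / r \<le> g a"
    proof (rule great)
      fix t :: real assume "0 \<le> t"
      then have "g (r *\<^sub>R a) \<le> p (r *\<^sub>R (a + t *\<^sub>R y)) - (r * t) * p y"
        using low[of "r * t" "r *\<^sub>R a"] r by (simp add: algebra_simps)
      then show "g (r *\<^sub>R a) / r \<le> p (a + t *\<^sub>R y) - t * p y"
        using r sublinear_scaleR[OF p, of r "a + t *\<^sub>R y"] by (simp add: field_simps)
    qed
    then show "g (r *\<^sub>R a) \<le> r * g a" using r by (simp add: field_simps)
  next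
    have "0 \<le> g 0"
      using sublinear_scaleR[OF p] by (intro great) simp
    moreover have "g 0 \<le> 0"
      using low[of 0 0] sublinear_zero[OF p] by simp
    ultimately show "g 0 = 0" by simp
  qed
  moreover have "g \<le> p"
    using low[of 0] by (simp add: le_fun_def)
  ultimately have "g = p" by (rule min)
  then have "p x \<le> p (x + y) - p y"
    using low[of 1 x] by simp
  with sublinear_add[OF p, of x y] show ?thesis by simp
qed

section \<open>Hahn--Banach over the reals\<close>

lemma sublinear_dominates_linear:
  fixes q :: "'a::real_vector \<Rightarrow> real"
  assumes "sublinear q"
  obtains u where "linear u" "\<And>x. u x \<le> q x"
proof -
  obtain p where p: "sublinear p" "p \<le> q" "\<And>p'. sublinear p' \<Longrightarrow> p' \<le> p \<Longrightarrow> p' = p"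
    using exists_minimal_sublinear[OF assms] by blast
  have add: "p (x + y) = p x + p y" for x y
    using p by (intro minimal_sublinear_add)
  \<comment> \<open>Additivity makes \<open>p\<close> odd, which extends positive homogeneity to
    negative scalars.\<close>
  have minus: "p (- x) = - p x" for x
    using add[of x "- x"] sublinear_zero[OF p(1)] by simp
  have "p (r *\<^sub>R x) = r * p x" for r x
    using sublinear_scaleR[OF p(1), of r x] sublinear_scaleR[OF p(1), of "- r" x] minus[of "r *\<^sub>R x"]
    by (cases "0 \<le> r") auto
  then have "linear p"
    using add by (intro linearI) auto
  then show thesis
    using p(2) by (intro that) (auto simp: le_fun_def)
qed

text \<open>The range of \<open>L\<close> replaces the usual subspace, so that a functional on it is
  prescribed by its pullback \<open>h\<close>. \<open>L\<close> may have a kernel: the bound at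
  \<open>v\<close> and at \<open>- v\<close> forces \<open>h\<close> to vanish there, so
  \<open>h\<close> factors through \<open>L\<close>.\<close>

lemma real_linear_extension:
  fixes L :: "'v::real_vector \<Rightarrow> 'a::real_normed_vector" and h :: "'v \<Rightarrow> real"
  assumes L: "linear L" and h: "linear h" and "0 \<le> c" and le: "\<And>v. h v \<le> c * norm (L v)"
  obtains u where "linear u" "\<And>v. u (L v) = h v" "\<And>z. u z \<le> c * norm z"
proof -
  \<comment> \<open>A linear \<open>u \<le> q\<close> is at most \<open>h v\<close> at \<open>L v\<close>, hence equal to it by applying this to \<open>- v\<close>.\<close>
  define q where "q = (\<lambda>z. INF v. h v + c * norm (z - L v))"
  \<comment> \<open>The hypothesis at \<open>- v\<close> and the triangle inequality bound the terms
    from below independently of \<open>v\<close>, so the infimum is finite.\<close>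
  have "- c * norm z \<le> h v + c * norm (z - L v)" for z v
  proof -
    have "- h v \<le> c * norm (L v)"
      using le[of "- v"] by (simp add: linear_neg[OF h] linear_neg[OF L])
    also have "\<dots> \<le> c * (norm (z - L v) + norm z)"
      using norm_triangle_ineq4[of z "z - L v"] \<open>0 \<le> c\<close> by (intro mult_left_mono) auto
    finally show ?thesis by (simp add: algebra_simps)
  qed
  then have bdd: "bdd_below (range (\<lambda>v. h v + c * norm (z - L v)))" for z
    by (intro bdd_belowI2)
  have low: "q z \<le> h v + c * norm (z - L v)" for z v
    unfolding q_def using bdd by (intro cINF_lower) auto
  have great: "a \<le> q z" if "\<And>v. a \<le> h v + c * norm (z - L v)" for a z
    unfolding q_def using that by (intro cINF_greatest) auto
  have "sublinear q"
  proof (rule sublinearI)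
    fix a b
    have sum: "q (a + b) \<le> (h v + c * norm (a - L v)) + (h w + c * norm (b - L w))" for v w
    proof -
      have "q (a + b) \<le> h (v + w) + c * norm ((a - L v) + (b - L w))"
        using low[of "a + b" "v + w"] by (simp add: linear_add[OF L] algebra_simps)
      also have "\<dots> \<le> h (v + w) + c * (norm (a - L v) + norm (b - L w))"
        using \<open>0 \<le> c\<close> by (intro add_left_mono mult_left_mono norm_triangle_ineq)
      finally show ?thesis by (simp add: linear_add[OF h] algebra_simps)
    qed
    have "q (a + b) - (h w + c * norm (b - L w)) \<le> q a" for w
      using sum by (intro great) (simp add: algebra_simps)
    then have "q (a + b) - q a \<le> q b"
      by (intro great) (simp add: algebra_simps)
    then show "q (a + b) \<le> q a + q b" by simp
  next
    fix r :: real and a assume r: "0 < r"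
    have "q (r *\<^sub>R a) / r \<le> q a"
    proof (rule great)
      fix v
      have "q (r *\<^sub>R a) \<le> r * h v + c * norm (r *\<^sub>R (a - L v))"
        using low[of "r *\<^sub>R a" "r *\<^sub>R v"]
        by (simp add: linear_scale[OF L] linear_scale[OF h] scaleR_diff_right)
      also have "\<dots> = r * (h v + c * norm (a - L v))"
        using r by (simp add: distrib_left mult.left_commute)
      finally show "q (r *\<^sub>R a) / r \<le> h v + c * norm (a - L v)"
        using r by (simp add: field_simps)
    qed
    then show "q (r *\<^sub>R a) \<le> r * q a" using r by (simp add: field_simps)
  next
    have "0 \<le> h v + c * norm (0 - L v)" for v
      using le[of "- v"] by (simp add: linear_neg[OF h] linear_neg[OF L])
    then have "0 \<le> q 0" by (rule great)
    moreover have "q 0 \<le> 0"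
      using low[of 0 0] by (simp add: linear_0[OF L] linear_0[OF h])
    ultimately show "q 0 = 0" by simp
  qed
  then obtain u where u: "linear u" "\<And>z. u z \<le> q z"
    using sublinear_dominates_linear by blast
  have le_h: "u (L v) \<le> h v" for v
    using u(2)[of "L v"] low[of "L v" v] by simp
  show thesis
  proof
    show "u (L v) = h v" for v
      using le_h[of v] le_h[of "- v"]
      by (simp add: linear_neg[OF h] linear_neg[OF L] linear_neg[OF u(1)])
    show "u z \<le> c * norm z" for z
      using u(2)[of z] low[of z 0] by (simp add: linear_0[OF L] linear_0[OF h])
  qed (rule u(1))
qed

section \<open>The scalar field as a subfield of the complex numbers\<close>

lemma to_complex_diff: "to_complex (a - b) = to_complex a - to_complex b"
  using to_complex_add[of "a - b" b] by simp

lemma to_complex_zero [simp]: "to_complex 0 = 0"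
  using to_complex_add[of 0 0] by simp

lemma to_complex_inject: "to_complex a = to_complex b \<longleftrightarrow> a = b"
  using norm_to_complex[of "a - b"] by (auto simp: to_complex_diff)

lemma to_complex_eqI: "to_complex a = to_complex b \<Longrightarrow> a = b"
  by (simp only: to_complex_inject)

text \<open>The image of 1 is idempotent, and injectivity excludes 0.\<close>

lemma to_complex_one [simp]: "to_complex (1::'k::real_or_complex) = 1"
  using to_complex_mult[of 1 "1::'k"] to_complex_inject[of 1 "0::'k"] by auto

lemma to_complex_of_real [simp]:
  "to_complex (of_real r :: 'k::real_or_complex) = complex_of_real r"
  by (simp add: of_real_def to_complex_scaleR)

lemma scalar_cnj_mult: "scalar_cnj (a * b) = scalar_cnj a * scalar_cnj (b :: 'k::real_or_complex)"
  by (rule to_complex_eqI) (simp add: to_complex_scalar_cnj to_complex_mult)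

lemma scalar_cnj_zero [simp]: "scalar_cnj (0 :: 'k::real_or_complex) = 0"
  by (rule to_complex_eqI) (simp add: to_complex_scalar_cnj)

lemma norm_scalar_cnj [simp]: "norm (scalar_cnj (a :: 'k::real_or_complex)) = norm a"
  by (metis complex_mod_cnj norm_to_complex to_complex_scalar_cnj)

lemma scalar_cnj_mult_self: "scalar_cnj a * (a :: 'k::real_or_complex) = of_real ((norm a)\<^sup>2)"
  by (rule to_complex_eqI)
    (simp only: to_complex_scalar_cnj to_complex_mult to_complex_of_real complex_norm_square
      norm_to_complex[of a, symmetric] mult.commute)

section \<open>Hahn--Banach over the scalar field\<close>

lemma normed_space_over_mult: "normed_space_over ((*) :: 'k::real_or_complex \<Rightarrow> 'k \<Rightarrow> 'k)"
  by unfold_locales (auto simp: algebra_simps norm_mult scaleR_conv_of_real)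

lemma linear_over_mult_left:
  "Vector_Spaces.linear s (*) f \<Longrightarrow> Vector_Spaces.linear s (*) (\<lambda>x. a * f x)"
  by (simp add: Vector_Spaces.linear_iff algebra_simps)

lemma linear_over_imp_linear:
  assumes "normed_space_over s" "normed_space_over s'" "Vector_Spaces.linear s s' f"
  shows "linear f"
proof -
  interpret Vector_Spaces.linear s s' f by fact
  interpret a: normed_space_over s by fact
  interpret b: normed_space_over s' by fact
  show ?thesis
    using scale by (intro linearI) (simp_all add: add flip: a.scale_of_real b.scale_of_real)
qed

text \<open>If all scalars are real, \<open>u\<close> read in \<open>'k\<close> is the functional.
  Otherwise it is the classical \<open>g x = u x - i u (i x)\<close>.\<close>

lemma linear_over_of_real_part:
  fixes scale :: "'k::real_or_complex \<Rightarrow> 'a::real_normed_vector \<Rightarrow> 'a"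
  assumes "normed_space_over scale" and u: "linear u"
  obtains g where "Vector_Spaces.linear scale (*) g" "\<And>x. Re (to_complex (g x)) = u x"
proof -
  interpret normed_space_over scale by fact
  have *: "\<exists>g. Vector_Spaces.linear scale (*) g \<and> (\<forall>x. Re (to_complex (g x)) = u x)"
    using range_to_complex[where 'a = 'k]
  proof
    assume "range (to_complex :: 'k \<Rightarrow> complex) = \<real>"
    then have real: "\<exists>r. c = of_real r" for c :: 'k
      by (metis Reals_cases rangeI to_complex_inject to_complex_of_real)
    have "of_real (u (scale c x)) = c * of_real (u x)" for c x
      using real[of c] by (auto simp: scale_of_real linear_scale[OF u])
    then have "Vector_Spaces.linear scale (*) (\<lambda>x. of_real (u x) :: 'k)"
      using normed_space_over_mult[where 'k = 'k]
      by (unfold_locales) (auto simp: linear_add[OF u] algebra_simps)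
    then show ?thesis by (intro exI conjI) auto
  next
    assume "range (to_complex :: 'k \<Rightarrow> complex) = UNIV"
    then have surj: "\<exists>c :: 'k. to_complex c = z" for z
      by (metis UNIV_I imageE)
    \<comment> \<open>\<open>j\<close> is the imaginary unit inside \<open>'k\<close>.\<close>
    obtain j :: 'k where j: "to_complex j = \<i>" using surj by blast
    have jj: "j * j = - 1"
      by (rule to_complex_eqI) (simp add: to_complex_mult j to_complex_diff[of 0, simplified])
    have ex: "\<exists>a b. c = of_real a + j * of_real b" for c :: 'k
      by (intro exI[of _ "Re (to_complex c)"] exI[of _ "Im (to_complex c)"])
        (rule to_complex_eqI, simp flip: complex_eq add: to_complex_mult to_complex_add j)
    define g where "g = (\<lambda>x. of_real (u x) - j * of_real (u (scale j x)) :: 'k)"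
    \<comment> \<open>For \<open>c = a + j b\<close> both \<open>c x\<close> and
      \<open>j (c x)\<close> are real combinations of \<open>x\<close> and \<open>j x\<close>, so
      real linearity of \<open>u\<close> suffices.\<close>
    have "g (scale c x) = c * g x" for c x
    proof -
      obtain a b where c: "c = of_real a + j * of_real b" using ex by blast
      have 1: "scale c x = a *\<^sub>R x + b *\<^sub>R scale j x"
        by (simp add: c scale_left_distrib scale_of_real[symmetric] mult.commute)
      have 2: "scale j (scale c x) = a *\<^sub>R scale j x - b *\<^sub>R x"
      proof -
        have "j * c = of_real a * j + of_real (- b)"
          using jj by (simp add: c distrib_left mult.assoc[symmetric])
        then show ?thesis
          by (metis add_uminus_conv_diff scaleR_left.minus scale_left_distrib scale_of_real scale_scale)
      qed
      have 3: "j * (j * z) = - z" for z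
        by (simp add: jj mult.assoc[symmetric])
      show ?thesis
        unfolding g_def 2 unfolding 1 unfolding c
        by (simp add: linear_add[OF u] linear_diff[OF u] linear_scale[OF u] algebra_simps 3)
    qed
    then have "Vector_Spaces.linear scale (*) g"
      using normed_space_over_mult[where 'k = 'k]
      by (unfold_locales) (auto simp: linear_add[OF u] algebra_simps g_def scale_right_distrib)
    then show ?thesis
      by (intro exI conjI) (auto simp: g_def to_complex_diff to_complex_mult j)
  qed
  then show thesis using that by blast
qed

text \<open>The real part of \<open>h\<close> is extended to a real functional \<open>u\<close>,
  which is the real part of a functional \<open>g\<close> over \<open>'k\<close>. Multiplying
  vectors by scalars of modulus 1 carries the bound and the equality from real parts to the
  functionals.\<close>

lemma linear_over_extension:
  fixes scaleV :: "'k::real_or_complex \<Rightarrow> 'v::real_normed_vector \<Rightarrow> 'v"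
    and scaleY :: "'k \<Rightarrow> 'b::real_normed_vector \<Rightarrow> 'b" and h :: "'v \<Rightarrow> 'k"
  assumes V: "normed_space_over scaleV" and Y: "normed_space_over scaleY"
    and L: "Vector_Spaces.linear scaleV scaleY L" and h: "Vector_Spaces.linear scaleV (*) h"
    and "0 \<le> c" and le: "\<And>v. norm (h v) \<le> c * norm (L v)"
  obtains g where "Vector_Spaces.linear scaleY (*) g" "\<And>v. g (L v) = h v"
    "\<And>z. norm (g z) \<le> c * norm z"
proof -
  interpret V: normed_space_over scaleV by fact
  interpret Y: normed_space_over scaleY by fact
  interpret L: Vector_Spaces.linear scaleV scaleY L by fact
  interpret h: Vector_Spaces.linear scaleV "(*)" h by fact
  note h_real = linear_over_imp_linear[OF V normed_space_over_mult h]
  have "linear (\<lambda>v. Re (to_complex (h v)))"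
    by (intro linearI) (simp_all add: linear_add[OF h_real] linear_scale[OF h_real]
        to_complex_add to_complex_scaleR)
  moreover have "Re (to_complex (h v)) \<le> c * norm (L v)" for v
    using le[of v] complex_Re_le_cmod[of "to_complex (h v)"] by (simp add: norm_to_complex)
  ultimately obtain u where u: "linear u" "\<And>v. u (L v) = Re (to_complex (h v))"
    "\<And>z. u z \<le> c * norm z"
    using real_linear_extension[OF linear_over_imp_linear[OF V Y L] _ \<open>0 \<le> c\<close>] by blast
  obtain g where g: "Vector_Spaces.linear scaleY (*) g" "\<And>z. Re (to_complex (g z)) = u z"
    using linear_over_of_real_part[OF Y u(1)] by blast
  interpret g: Vector_Spaces.linear scaleY "(*)" g by fact
  have phase: "\<exists>t. norm t = 1 \<and> t * a = of_real (norm a)" for a :: 'k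
    by (cases "a = 0") (auto intro: exI[of _ 1] exI[of _ "of_real (norm a) / a"] simp: norm_divide)
  show thesis
  proof
    fix v
    obtain t where t: "norm t = 1" "t * (g (L v) - h v) = of_real (norm (g (L v) - h v))"
      using phase by blast
    \<comment> \<open>The real parts of \<open>g (L v)\<close> and \<open>h v\<close> agree at every
      vector, in particular at \<open>scaleV t v\<close>, where the difference is the real number
      \<open>norm (g (L v) - h v)\<close>.\<close>
    have "t * (g (L v) - h v) = g (L (scaleV t v)) - h (scaleV t v)"
      by (simp add: L.scale g.scale h.scale algebra_simps)
    then have "Re (to_complex (t * (g (L v) - h v))) = 0"
      by (simp add: to_complex_diff g u)
    then show "g (L v) = h v" by (simp add: t)
  next
    fix z
    obtain t where t: "norm t = 1" "t * g z = of_real (norm (g z))"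
      using phase by blast
    have "norm (g z) = Re (to_complex (g (scaleY t z)))"
      by (simp add: g.scale t)
    also have "\<dots> \<le> c * norm z"
      using u(3)[of "scaleY t z"] by (simp add: g Y.norm_scale t)
    finally show "norm (g z) \<le> c * norm z" .
  qed (rule g)
qed

section \<open>Support functionals and semi-inner-products\<close>

text \<open>These are the values of the normalized duality map at \<open>w\<close>, that is, the
  possible sections \<open>z \<mapsto> [z, w]\<close> of a semi-inner-product. For
  \<open>w = 0\<close> only the zero functional qualifies.\<close>

definition support_functional ::
  "('k::real_or_complex \<Rightarrow> 'a::real_normed_vector \<Rightarrow> 'a) \<Rightarrow> 'a \<Rightarrow> ('a \<Rightarrow> 'k) \<Rightarrow> bool"
  where "support_functional scale w f \<longleftrightarrow> Vector_Spaces.linear scale (*) f \<and>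
    f w = of_real ((norm w)\<^sup>2) \<and> (\<forall>z. norm (f z) \<le> norm w * norm z)"

text \<open>Hahn--Banach extends \<open>c w \<mapsto> c * (norm w)\<^sup>2\<close> from the line
  through \<open>w\<close>. Parametrizing the line by the scalars covers \<open>w = 0\<close> as
  well.\<close>

lemma support_functional_exists:
  fixes scale :: "'k::real_or_complex \<Rightarrow> 'a::real_normed_vector \<Rightarrow> 'a"
  assumes "normed_space_over scale"
  shows "\<exists>f. support_functional scale w f"
proof -
  interpret normed_space_over scale by fact
  interpret K: normed_space_over "(*) :: 'k \<Rightarrow> 'k \<Rightarrow> 'k" by (rule normed_space_over_mult)
  have "Vector_Spaces.linear ((*) :: 'k \<Rightarrow> 'k \<Rightarrow> 'k) scale (\<lambda>c. scale c w)"
    by unfold_locales (auto simp: scale_left_distrib)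
  moreover have "Vector_Spaces.linear (*) (*) (\<lambda>c::'k. c * of_real ((norm w)\<^sup>2))"
    by unfold_locales (simp_all add: distrib_right)
  moreover have "norm (c * of_real ((norm w)\<^sup>2) :: 'k) \<le> norm w * norm (scale c w)" for c
    by (simp add: norm_mult norm_scale norm_power power2_eq_square)
  ultimately obtain f where f: "Vector_Spaces.linear scale (*) f"
    "\<And>c. f (scale c w) = c * of_real ((norm w)\<^sup>2)" "\<And>z. norm (f z) \<le> norm w * norm z"
    using linear_over_extension[OF normed_space_over_mult assms, of "\<lambda>c. scale c w"
        "\<lambda>c. c * of_real ((norm w)\<^sup>2)" "norm w"] by auto
  then show ?thesis
    unfolding support_functional_def using f(2)[of 1] by (intro exI[of _ f]) auto
qed

text \<open>
  Conjugate homogeneity in the second argument is obtained by choosing a support functional only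
  for one representative of each line, taking \<open>w\<close> itself on the line through \<open>w\<close>.
\<close>

lemma semi_inner_product_with_support_functional:
  fixes scale :: "'k::real_or_complex \<Rightarrow> 'a::real_normed_vector \<Rightarrow> 'a"
  assumes "normed_space_over scale" and f: "support_functional scale w f"
  obtains sip where "semi_inner_product scale sip" "\<And>z. sip z w = f z"
proof -
  interpret normed_space_over scale by fact
  define J where "J = (\<lambda>v. if v = w then f else SOME f. support_functional scale v f)"
  have J: "support_functional scale v (J v)" for v
    using f someI_ex[OF support_functional_exists[OF assms(1), of v]] by (auto simp: J_def)
  have J_linear: "Vector_Spaces.linear scale (*) (J v)" for v
    using J by (auto simp: support_functional_def)
  have J_add: "J v (a + b) = J v a + J v b" and J_scale: "J v (scale c a) = c * J v a" for v a b c
  proof -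
    interpret Vector_Spaces.linear scale "(*)" "J v" by (rule J_linear)
    show "J v (a + b) = J v a + J v b" "J v (scale c a) = c * J v a"
      by (rule add, rule scale)
  qed
  have J_self: "J v v = of_real ((norm v)\<^sup>2)" and J_le: "norm (J v z) \<le> norm v * norm z" for v z
    using J by (auto simp: support_functional_def)
  \<comment> \<open>\<open>line v u\<close> says that \<open>v\<close> and \<open>u\<close> span the
    same subspace. The predicate \<open>line v\<close> does not change under nonzero scaling of
    \<open>v\<close>, so the choice operator in \<open>r\<close> picks the same representative for
    all multiples.\<close>
  define line where "line = (\<lambda>v u. \<exists>c. c \<noteq> 0 \<and> v = scale c u)"
  have line_scale: "line (scale d v) = line v" if "d \<noteq> 0" for d v
  proof (rule ext)
    fix u
    have "scale d v = scale c u \<longleftrightarrow> v = scale (c / d) u" for c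
      using that by (metis divide_inverse left_inverse mult.commute mult.left_commute
          scale_one scale_scale)
    then show "line (scale d v) u = line v u"
      unfolding line_def using that
      by (metis divide_eq_0_iff mult_eq_0_iff nonzero_mult_div_cancel_right)
  qed
  define r where "r = (\<lambda>v. if line v w then w else SOME u. line v u)"
  have "line v v" for v
    unfolding line_def by (intro exI[of _ 1]) simp
  then have r: "line v (r v)" "r w = w" for v
    by (auto simp: r_def intro: someI)
  have r_scale: "r (scale d v) = r v" if "d \<noteq> 0" for d v
    by (simp add: r_def line_scale[OF that])
  \<comment> \<open>\<open>k v\<close> is the coordinate of \<open>v\<close> along its
    representative, unique for \<open>v \<noteq> 0\<close>.\<close>
  define k where "k = (\<lambda>v. SOME c. v = scale c (r v))"
  have k: "v = scale (k v) (r v)" for v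
    unfolding k_def by (rule someI_ex) (use r(1)[of v] in \<open>auto simp: line_def\<close>)
  have r_nonzero: "r v \<noteq> 0" if "v \<noteq> 0" for v
    using k[of v] that by auto
  have k_scale: "k (scale d v) = d * k v" if "d \<noteq> 0" "v \<noteq> 0" for d v
  proof -
    have "scale (k (scale d v)) (r v) = scale (d * k v) (r v)"
      by (metis k r_scale scale_scale that(1))
    then show ?thesis using r_nonzero[OF that(2)] by simp
  qed
  \<comment> \<open>The conjugated coordinate provides conjugate homogeneity. At
    \<open>v = 0\<close> the coordinate is arbitrary, and the value is set to 0.\<close>
  define sip where "sip = (\<lambda>z v. if v = 0 then 0 else scalar_cnj (k v) * J (r v) z)"
  have self: "sip v v = of_real ((norm v)\<^sup>2)" for v
  proof (cases "v = 0")
    case False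
    have "J (r v) v = k v * of_real ((norm (r v))\<^sup>2)"
      using J_scale[of "r v" "k v" "r v"] by (simp add: J_self flip: k)
    then have "sip v v = (scalar_cnj (k v) * k v) * of_real ((norm (r v))\<^sup>2)"
      using False by (simp add: sip_def)
    also have "\<dots> = of_real ((norm (k v) * norm (r v))\<^sup>2)"
      by (simp add: scalar_cnj_mult_self power_mult_distrib)
    also have "norm (k v) * norm (r v) = norm v"
      by (metis k norm_scale)
    finally show ?thesis .
  qed (simp add: sip_def)
  have le: "norm (sip z v) \<le> norm z * norm v" for z v
  proof (cases "v = 0")
    case False
    have "norm (sip z v) \<le> norm (k v) * (norm (r v) * norm z)"
      using False J_le by (simp add: sip_def norm_mult mult_left_mono)
    also have "\<dots> = norm z * norm v"
      by (subst (3) k) (simp add: norm_scale)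
    finally show ?thesis .
  qed (simp add: sip_def)
  have "semi_inner_product scale sip"
  proof unfold_locales
    show "sip (a + b) v = sip a v + sip b v" for a b v
      by (simp add: sip_def J_add algebra_simps)
    show "sip (scale c a) v = c * sip a v" for c a v
      by (simp add: sip_def J_scale algebra_simps)
    show "0 < to_complex (sip v v)" if "v \<noteq> 0" for v
      using that by (simp add: self less_complex_def del: of_real_power)
    show "complex_of_real ((norm (sip a v))\<^sup>2) \<le> to_complex (sip a a * sip v v)" for a v
    proof -
      have "(norm (sip a v))\<^sup>2 \<le> (norm a)\<^sup>2 * (norm v)\<^sup>2"
        using le[of a v] by (metis norm_ge_zero power_mono power_mult_distrib)
      moreover have "to_complex (sip a a * sip v v) = complex_of_real ((norm a)\<^sup>2 * (norm v)\<^sup>2)"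
        by (simp only: self to_complex_mult to_complex_of_real of_real_mult)
      ultimately show ?thesis by (simp only: less_eq_complex_def Re_complex_of_real Im_complex_of_real)
    qed
    show "sip a (scale c v) = scalar_cnj c * sip a v" for a c v
      by (cases "c = 0 \<or> v = 0") (auto simp: sip_def k_scale r_scale scalar_cnj_mult)
    show "sip v v = of_real ((norm v)\<^sup>2)" for v by (rule self)
  qed
  moreover have "sip z w = f z" for z
  proof (cases "w = 0")
    case True
    then show ?thesis using f by (auto simp: sip_def support_functional_def)
  next
    case False
    \<comment> \<open>\<open>w\<close> represents its own line, so its coordinate is 1 and its
      section is \<open>J w = f\<close>.\<close>
    have "scale (k w) w = scale 1 w"
      using k[of w] by (simp add: r)
    then have "k w = 1" using False by (simp only: scale_cancel_right) simp
    moreover have "scalar_cnj (1::'k) = 1"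
      using scalar_cnj_mult_self[of "1::'k"] by simp
    ultimately show ?thesis using False by (simp add: sip_def r J_def)
  qed
  ultimately show thesis by (rule that)
qed

theorem theorem2p6:
  fixes scaleX :: "'k::real_or_complex \<Rightarrow> 'a::real_normed_vector \<Rightarrow> 'a"
    and scaleY :: "'k \<Rightarrow> 'b::real_normed_vector \<Rightarrow> 'b"
    and T :: "'a \<Rightarrow> 'b" and x :: 'a
  assumes "normed_space_over scaleX" and "normed_space_over scaleY"
    and "bounded_linear_over scaleX scaleY T"
    and "norm x = 1"
  shows "x \<in> min_norm_attainment_set T \<longleftrightarrow>
    (\<exists>sipX sipY. semi_inner_product scaleX sipX \<and> semi_inner_product scaleY sipY \<and>
      (\<forall>y. sipY (T y) (T x) = of_real ((min_norm T)\<^sup>2) * sipX y x))"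
    (is "_ \<longleftrightarrow> ?sips")
proof -
  define m where "m = min_norm T"
  interpret X: normed_space_over scaleX by fact
  have T: "Vector_Spaces.linear scaleX scaleY T"
    using assms(3) by (simp add: bounded_linear_over_def)
  interpret T: Vector_Spaces.linear scaleX scaleY T by fact
  \<comment> \<open>\<open>x\<close> makes the set of norms nonempty, so its infimum inherits the
    lower bound 0.\<close>
  have m_nonneg: "0 \<le> m"
    unfolding m_def min_norm_def using assms(4) by (intro cInf_greatest) auto
  have unit: "m \<le> norm (T z)" if "norm z = 1" for z
    unfolding m_def min_norm_def using that by (intro cInf_lower bdd_belowI[of _ 0]) auto
  have lower: "m * norm z \<le> norm (T z)" for z
  proof (cases "z = 0")
    case False
    have "T (z /\<^sub>R norm z) = T z /\<^sub>R norm z"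
      by (rule linear_scale[OF linear_over_imp_linear[OF assms(1,2) T]])
    with unit[of "z /\<^sub>R norm z"] False show ?thesis
      by (simp add: field_simps)
  qed simp
  show ?thesis
  proof
    assume "x \<in> min_norm_attainment_set T"
    then have Tx: "norm (T x) = m" by (simp add: min_norm_attainment_set_def m_def)
    obtain f where f: "support_functional scaleX x f"
      using support_functional_exists[OF assms(1)] by blast
    then have f_linear: "Vector_Spaces.linear scaleX (*) f" and fx: "f x = 1"
      and f_le: "\<And>z. norm (f z) \<le> norm z"
      using assms(4) by (auto simp: support_functional_def)
    have "Vector_Spaces.linear scaleX (*) (\<lambda>z. of_real (m\<^sup>2) * f z)"
      using f_linear by (rule linear_over_mult_left)
    \<comment> \<open>One factor \<open>m\<close> is spent on \<open>lower\<close>; the other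
      becomes the norm bound of the extension, which is \<open>norm (T x)\<close>.\<close>
    moreover have "norm (of_real (m\<^sup>2) * f z) \<le> m * norm (T z)" for z
    proof -
      have "norm (of_real (m\<^sup>2) * f z) = m * (m * norm (f z))"
        using m_nonneg by (simp add: norm_mult norm_power power2_eq_square)
      also have "\<dots> \<le> m * (m * norm z)"
        using m_nonneg f_le by (intro mult_left_mono) auto
      also have "\<dots> \<le> m * norm (T z)"
        using m_nonneg lower by (intro mult_left_mono)
      finally show ?thesis .
    qed
    ultimately obtain g where g: "Vector_Spaces.linear scaleY (*) g"
      "\<And>z. g (T z) = of_real (m\<^sup>2) * f z" "\<And>z. norm (g z) \<le> m * norm z"
      using linear_over_extension[OF assms(1,2) T _ m_nonneg] by blast
    then have "support_functional scaleY (T x) g"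
      by (simp add: support_functional_def Tx fx)
    then obtain sipY where "semi_inner_product scaleY sipY" "\<And>z. sipY z (T x) = g z"
      using semi_inner_product_with_support_functional[OF assms(2)] by blast
    moreover obtain sipX where "semi_inner_product scaleX sipX" "\<And>z. sipX z x = f z"
      using semi_inner_product_with_support_functional[OF assms(1) f] by blast
    ultimately show ?sips
      using g(2) by (intro exI[of _ sipX] exI[of _ sipY]) (simp add: m_def)
  next
    assume ?sips
    then obtain sipX sipY where "semi_inner_product scaleX sipX" "semi_inner_product scaleY sipY"
      and eq: "sipY (T x) (T x) = of_real (m\<^sup>2) * sipX x x"
      by (auto simp: m_def)
    \<comment> \<open>By compatibility \<open>sipY (T x) (T x)\<close> is the squared norm of
      \<open>T x\<close>, and \<open>sipX x x = 1\<close>.\<close>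
    then have "of_real ((norm (T x))\<^sup>2) = (of_real (m\<^sup>2) :: 'k)"
      using assms(4) by (simp add: semi_inner_product.sip_compatible)
    then have "(norm (T x))\<^sup>2 = m\<^sup>2" by (simp only: of_real_eq_iff)
    then have "norm (T x) = m" using m_nonneg by simp
    then show "x \<in> min_norm_attainment_set T"
      using assms(4) by (simp add: min_norm_attainment_set_def m_def)
  qed
qed

end
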